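(* Let $F$ be a random variable with $\mathbb{E}[F]=0$, $\mathrm{Var}(F)=1$ and an absolutely continuous density $p_F$, and let $Z$ be a standard normal random variable. For any $x\in\mathbb{R}$, we have $$|P(F\ge x)-P(Z\ge x)|\le\sqrt{I(F\|Z)/2}\,\left(\sqrt{P(|F|\ge|x|)}+\sqrt{P(|Z|\ge|x|)}\right).$$
   Context: Fisher information distance: for $F$ with mean $0$, variance $1$ and absolutely continuous density $p_F$, let $\rho_F=p_F'/p_F$ be the score function ($p_F'$ a Radon–Nikodym derivative of $p_F$). Then $I(F\|Z)=\mathbb{E}[(\rho_F(F)+F)^2]$ (possibly $+\infty$, in which case the inequality is trivial). *)

theory Defs
  imports "HOL-Probability.Probability"
begin

definition absolutely_continuous_on :: "real set \<Rightarrow> (real \<Rightarrow> real) \<Rightarrow> bool" where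
  "absolutely_continuous_on S f \<longleftrightarrow>
     (\<forall>\<epsilon>>0. \<exists>\<delta>>0. \<forall>(n::nat) (u::nat \<Rightarrow> real) (v::nat \<Rightarrow> real).
        (\<forall>i<n. u i \<le> v i \<and> {u i..v i} \<subseteq> S) \<longrightarrow>
        disjoint_family_on (\<lambda>i. {u i<..<v i}) {..<n} \<longrightarrow>
        (\<Sum>i<n. v i - u i) < \<delta> \<longrightarrow>
        (\<Sum>i<n. \<bar>f (v i) - f (u i)\<bar>) < \<epsilon>)"

text \<open>
  Absolute continuity of a function on the whole line is required on compact intervals only. This
  is the weakest of the usual readings, and it is the one under which the function has a (locally
  integrable) Radon--Nikodym derivative.
\<close>

definition locally_absolutely_continuous :: "(real \<Rightarrow> real) \<Rightarrow> bool" where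
  "locally_absolutely_continuous f \<longleftrightarrow> (\<forall>a b. absolutely_continuous_on {a..b} f)"

text \<open>
  The function \<open>f'\<close> is the density, with respect to Lebesgue measure, of the (locally finite signed)
  measure whose value on the interval from \<open>a\<close> to \<open>b\<close> is \<open>f b - f a\<close>.
\<close>

definition has_Radon_Nikodym_derivative :: "(real \<Rightarrow> real) \<Rightarrow> (real \<Rightarrow> real) \<Rightarrow> bool" where
  "has_Radon_Nikodym_derivative f f' \<longleftrightarrow>
     (\<forall>a b. a \<le> b \<longrightarrow>
        set_integrable lborel {a..b} f' \<and> (LBINT t:{a..b}. f' t) = f b - f a)"

text \<open>
  The convention \<open>y / 0 = 0\<close> is immaterial for a density \<open>p\<close>: the random variable with density \<open>p\<close>
  takes values in \<open>{y. p y = 0}\<close> with probability \<open>0\<close>.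
\<close>

definition score :: "(real \<Rightarrow> real) \<Rightarrow> (real \<Rightarrow> real) \<Rightarrow> real \<Rightarrow> real" where
  "score p p' y = p' y / p y"

text \<open>
  Here \<open>p\<close> is the density of \<open>F\<close> and \<open>p'\<close> a Radon--Nikodym derivative of \<open>p\<close>. The expectation of the
  nonnegative integrand is a nonnegative extended real, so that it may be infinite.
\<close>

definition fisher_information_distance ::
  "'a measure \<Rightarrow> ('a \<Rightarrow> real) \<Rightarrow> (real \<Rightarrow> real) \<Rightarrow> (real \<Rightarrow> real) \<Rightarrow> ennreal" where
  "fisher_information_distance M F p p' =
     (\<integral>\<^sup>+ \<omega>. ennreal ((score p p' (F \<omega>) + F \<omega>)\<^sup>2) \<partial>M)"

definition ennreal_sqrt :: "ennreal \<Rightarrow> ennreal" where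
  "ennreal_sqrt a = (if a = \<infinity> then \<infinity> else ennreal (sqrt (enn2real a)))"

end

theory Submission
  imports Defs
begin

text \<open>
  Write \<open>\<phi>\<close> for the standard normal density and \<open>\<gamma>\<close> for the standard normal law. The function
  \<open>g = sqrt (p / \<phi>)\<close> turns the Fisher information distance into a Dirichlet energy. Since
  \<open>p' / p + y\<close> is the logarithmic derivative of \<open>p / \<phi> = g\<^sup>2\<close>, it equals \<open>2 g' / g\<close>, and so
  \<open>I(F\<parallel>Z) = 4 \<integral> g'\<^sup>2 d\<gamma>\<close>. As \<open>\<integral> g\<^sup>2 d\<gamma> = \<integral> p = 1\<close>, the variance of \<open>g\<close> under \<open>\<gamma>\<close> is \<open>1 - m\<^sup>2\<close>, where
  \<open>m = \<integral> g d\<gamma> = \<integral> sqrt p sqrt \<phi>\<close> is the affinity of the two densities, and the Gaussian Poincare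
  inequality gives \<open>1 - m\<^sup>2 \<le> I(F\<parallel>Z) / 4\<close>. Because \<open>0 \<le> m \<le> 1\<close>, the squared Hellinger distance satisfies
  \<open>\<integral> (sqrt p - sqrt \<phi>)\<^sup>2 = 2 - 2 m \<le> 2 - 2 m\<^sup>2 \<le> I(F\<parallel>Z) / 2\<close> (\<open>Hellinger_le_Fisher\<close>).

  For every event \<open>A\<close>, factor \<open>p - \<phi> = (sqrt p - sqrt \<phi>) (sqrt p + sqrt \<phi>)\<close>. The Cauchy--Schwarz
  inequality bounds \<open>\<bar>P(F \<in> A) - P(Z \<in> A)\<bar>\<close> by the Hellinger distance times
  \<open>sqrt P(F \<in> A) + sqrt P(Z \<in> A)\<close> (\<open>event_difference_le_Fisher\<close>). The theorem is the case of the
  half-line beyond \<open>x\<close> that points away from the origin: up to sign, complementary events have the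
  same difference of probabilities, so for \<open>x < 0\<close> the event \<open>F < x\<close> replaces \<open>F \<ge> x\<close>.

  The Poincare inequality is proved from the two-point form of the variance,
  \<open>2 Var(g) = \<integral>\<integral> (g b - g a)\<^sup>2 d\<gamma>(a) d\<gamma>(b)\<close>. Bounding \<open>(g b - g a)\<^sup>2\<close> by \<open>(b - a) \<integral>\<^sub>a\<^sup>b g'\<^sup>2\<close> for \<open>a \<le> b\<close> and
  exchanging the integrals leaves, in front of \<open>g' s\<close> squared, the weight
  \<open>\<integral>\<integral> (b - a) d\<gamma>(a) d\<gamma>(b)\<close> over \<open>a \<le> s \<le> b\<close>, which is exactly \<open>\<phi> s\<close>
  (\<open>std_normal_straddling_gap\<close>). Only an upper bound for the increments of \<open>g\<close> enters, so that the
  failure of \<open>g\<close> to be differentiable at zeros of \<open>p\<close> does no harm.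
\<close>

section \<open>Increments of the weighted square root of an absolutely continuous function\<close>

text \<open>
  A bound by a measure is additive over adjacent half-open intervals, so it may be chained along a
  partition into pieces shorter than \<open>\<delta>\<close>. Half-open intervals tile without overlap.
\<close>

lemma increment_le_emeasure_from_local:
  fixes f :: "real \<Rightarrow> real" and \<mu> :: "real measure"
  assumes sets [simp]: "sets \<mu> = sets borel" and "a \<le> b" and "\<delta> > 0"
    and local: "\<And>s t. a \<le> s \<Longrightarrow> s \<le> t \<Longrightarrow> t \<le> b \<Longrightarrow> t - s < \<delta> \<Longrightarrow>
                  ennreal \<bar>f t - f s\<bar> \<le> emeasure \<mu> {s<..t}"
  shows "ennreal \<bar>f b - f a\<bar> \<le> emeasure \<mu> {a<..b}"
proof -
  have step: "ennreal \<bar>f t - f a\<bar> \<le> emeasure \<mu> {a<..t}"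
    if "a \<le> t" "t \<le> b" "t - a \<le> real n * (\<delta> / 2)" for n t
    using that
  proof (induction n arbitrary: t)
    case 0
    then show ?case by simp
  next
    case (Suc n)
    define s where "s = max a (t - \<delta> / 2)"
    have s: "a \<le> s" "s \<le> t" "t - s < \<delta>" "s - a \<le> real n * (\<delta> / 2)"
      using Suc.prems \<open>\<delta> > 0\<close> by (auto simp: s_def algebra_simps max_def)
    have "ennreal \<bar>f t - f a\<bar> \<le> ennreal (\<bar>f s - f a\<bar> + \<bar>f t - f s\<bar>)"
      by (intro ennreal_leI) simp
    also have "\<dots> = ennreal \<bar>f s - f a\<bar> + ennreal \<bar>f t - f s\<bar>"
      by simp
    also have "\<dots> \<le> emeasure \<mu> {a<..s} + emeasure \<mu> {s<..t}"
      using s Suc.prems by (intro add_mono Suc.IH local) auto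
    also have "\<dots> = emeasure \<mu> ({a<..s} \<union> {s<..t})"
      by (intro plus_emeasure) auto
    also have "{a<..s} \<union> {s<..t} = {a<..t}"
      using s by auto
    finally show ?case .
  qed
  obtain n where "(b - a) / (\<delta> / 2) \<le> real n"
    using real_arch_simple by blast
  then show ?thesis
    using step[of b n] \<open>\<delta> > 0\<close> \<open>a \<le> b\<close> by (simp add: field_simps)
qed

lemma RN_derivative_borel_measurable:
  assumes "has_Radon_Nikodym_derivative p p'"
  shows "p' \<in> borel_measurable borel"
proof (rule borel_measurable_LIMSEQ_real)
  fix n :: nat
  have "set_integrable lborel {- real n..real n} p'"
    using assms unfolding has_Radon_Nikodym_derivative_def by auto
  then show "(\<lambda>x. indicator {- real n..real n} x *\<^sub>R p' x) \<in> borel_measurable borel"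
    unfolding set_integrable_def by (simp add: borel_measurable_integrable)
next
  fix x :: real
  obtain N :: nat where "\<bar>x\<bar> \<le> real N"
    using real_arch_simple by blast
  then have "\<forall>\<^sub>F n in sequentially. indicator {- real n..real n} x *\<^sub>R p' x = p' x"
    by (intro eventually_sequentiallyI[of N]) (auto simp: indicator_def)
  then show "(\<lambda>n. indicator {- real n..real n} x *\<^sub>R p' x) \<longlonglongrightarrow> p' x"
    by (rule tendsto_eventually)
qed

lemma locally_absolutely_continuous_imp_continuous:
  assumes "locally_absolutely_continuous f"
  shows "continuous_on UNIV f"
  unfolding continuous_on_iff
proof (intro ballI allI impI)
  fix x e :: real assume "e > 0"
  have ac: "absolutely_continuous_on {x - 1..x + 1} f"
    using assms unfolding locally_absolutely_continuous_def by blast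
  obtain \<delta> where "\<delta> > 0" and \<delta>: "\<And>(n::nat) (u::nat \<Rightarrow> real) v.
      (\<forall>i<n. u i \<le> v i \<and> {u i..v i} \<subseteq> {x - 1..x + 1}) \<Longrightarrow>
      disjoint_family_on (\<lambda>i. {u i<..<v i}) {..<n} \<Longrightarrow>
      (\<Sum>i<n. v i - u i) < \<delta> \<Longrightarrow> (\<Sum>i<n. \<bar>f (v i) - f (u i)\<bar>) < e"
    using ac \<open>e > 0\<close> unfolding absolutely_continuous_on_def by blast
  have "dist (f y) (f x) < e" if "dist y x < min \<delta> 1" for y
  proof (cases "x \<le> y")
    case True
    then show ?thesis
      using \<delta>[of 1 "\<lambda>_. x" "\<lambda>_. y"] that by (auto simp: dist_real_def disjoint_family_on_def)
  next
    case False
    then show ?thesis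
      using \<delta>[of 1 "\<lambda>_. y" "\<lambda>_. x"] that
      by (auto simp: dist_real_def disjoint_family_on_def abs_minus_commute)
  qed
  then show "\<exists>d>0. \<forall>x'\<in>UNIV. dist x' x < d \<longrightarrow> dist (f x') (f x) < e"
    using \<open>\<delta> > 0\<close> by (intro exI[of _ "min \<delta> 1"]) auto
qed

text \<open>
  One half of the fundamental theorem of calculus for \<open>\<psi> sqrt p\<close> on an interval where \<open>p > 0\<close>; the
  integrand on the right is the derivative given by the product and chain rules. On a short interval
  from \<open>s\<close> to \<open>t\<close>, write the increment of \<open>sqrt p\<close> as the increment of \<open>p\<close> divided by
  \<open>sqrt (p t) + sqrt (p s)\<close>. This makes the increment of \<open>\<psi> sqrt p\<close> the integral of a combination of
  \<open>p'\<close> and \<open>\<psi>'\<close> with coefficients constant in the integration variable. By uniform continuity these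
  coefficients differ by at most \<open>\<epsilon>\<close> from the ones wanted, at a cost of \<open>\<epsilon> (\<bar>p'\<bar> + \<bar>\<psi>'\<bar>)\<close>. Chaining the
  short intervals and letting \<open>\<epsilon>\<close> tend to \<open>0\<close> gives the claim.
\<close>

lemma abs_weighted_sqrt_increment_le:
  fixes p p' \<psi> \<psi>' :: "real \<Rightarrow> real"
  assumes p': "has_Radon_Nikodym_derivative p p'"
    and p_cont: "continuous_on UNIV p"
    and \<psi>: "\<And>y. (\<psi> has_real_derivative \<psi>' y) (at y)"
    and \<psi>'_cont: "continuous_on UNIV \<psi>'"
    and "a \<le> b" and p_pos: "\<And>y. y \<in> {a..b} \<Longrightarrow> p y > 0"
  shows "ennreal \<bar>\<psi> b * sqrt (p b) - \<psi> a * sqrt (p a)\<bar>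
    \<le> (\<integral>\<^sup>+r\<in>{a..b}. ennreal \<bar>\<psi> r * p' r / (2 * sqrt (p r)) + \<psi>' r * sqrt (p r)\<bar> \<partial>lborel)"
    (is "_ \<le> (\<integral>\<^sup>+r\<in>{a..b}. ennreal \<bar>?w r\<bar> \<partial>lborel)")
proof -
  \<comment> \<open>\<open>K (s, t)\<close> is the coefficient of \<open>p'\<close>; at \<open>s = t = r\<close> it is the one that occurs in \<open>?w r\<close>.\<close>
  define K where "K = (\<lambda>(s, t). \<psi> t / (sqrt (p t) + sqrt (p s)))"
  have \<psi>_cont: "continuous_on UNIV \<psi>"
    using \<psi> by (intro DERIV_continuous_on) (auto intro: has_field_derivative_at_within)
  note [measurable] = RN_derivative_borel_measurable[OF p']
    borel_measurable_continuous_onI[OF p_cont] borel_measurable_continuous_onI[OF \<psi>_cont]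
    borel_measurable_continuous_onI[OF \<psi>'_cont]
  define H where "H r = \<bar>p' r\<bar> + \<bar>\<psi>' r\<bar>" for r
  have p'_int: "set_integrable lborel {s..t} p'" and p'_eq: "(LBINT r:{s..t}. p' r) = p t - p s"
    if "s \<le> t" for s t
    using p' that unfolding has_Radon_Nikodym_derivative_def by auto
  have \<psi>'_int: "set_integrable lborel {s..t} \<psi>'" for s t
    by (intro borel_integrable_atLeastAtMost' continuous_on_subset[OF \<psi>'_cont]) auto
  have \<psi>'_eq: "(LBINT r:{s..t}. \<psi>' r) = \<psi> t - \<psi> s" if "s \<le> t" for s t
    using integral_FTC_Icc_real[of s t \<psi> \<psi>'] that \<psi> \<psi>'_cont
    by (auto simp: set_lebesgue_integral_def mult.commute continuous_on_eq_continuous_at)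
  have H_nonneg: "H r \<ge> 0" for r
    by (simp add: H_def)
  have [measurable]: "H \<in> borel_measurable borel"
    unfolding H_def by measurable
  have "set_integrable lborel {a..b} (\<lambda>r. \<bar>p' r\<bar> + \<bar>\<psi>' r\<bar>)"
    by (intro set_integral_add set_integrable_abs p'_int \<psi>'_int \<open>a \<le> b\<close>)
  then have H_fin: "(\<integral>\<^sup>+r\<in>{a..b}. ennreal (H r) \<partial>lborel) < \<infinity>"
    unfolding set_integrable_def H_def
    by (subst (asm) integrable_iff_bounded)
       (auto simp: indicator_mult_ennreal mult.commute cong: nn_integral_cong
             elim!: le_less_trans[rotated] intro!: nn_integral_mono split: split_indicator)
  have root_pos: "sqrt (p y) > 0" if "y \<in> {a..b}" for y
    using p_pos[OF that] by simp
  then have root_sum: "sqrt (p y) + sqrt (p y') \<noteq> 0" if "y \<in> {a..b}" "y' \<in> {a..b}" for y y'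
    using that by (metis add_pos_pos less_irrefl)
  then have K_cont: "continuous_on ({a..b} \<times> {a..b}) K"
    unfolding K_def case_prod_unfold
    by (intro continuous_intros continuous_on_compose2[OF p_cont] continuous_on_compose2[OF \<psi>_cont])
       auto
  have root_cont: "continuous_on {a..b} (\<lambda>r. sqrt (p r))"
    by (intro continuous_intros continuous_on_subset[OF p_cont]) auto
  have approx: "ennreal \<bar>\<psi> b * sqrt (p b) - \<psi> a * sqrt (p a)\<bar>
      \<le> (\<integral>\<^sup>+r\<in>{a..b}. ennreal \<bar>?w r\<bar> \<partial>lborel) + ennreal \<epsilon> * (\<integral>\<^sup>+r\<in>{a..b}. ennreal (H r) \<partial>lborel)"
    if "\<epsilon> > 0" for \<epsilon>
  proof -
    have "uniformly_continuous_on ({a..b} \<times> {a..b}) K"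
      by (intro compact_uniformly_continuous K_cont compact_Times compact_Icc)
    then obtain d1 where "d1 > 0" and d1: "\<And>z z'. z \<in> {a..b} \<times> {a..b} \<Longrightarrow> z' \<in> {a..b} \<times> {a..b} \<Longrightarrow>
        dist z' z < d1 \<Longrightarrow> dist (K z') (K z) < \<epsilon>"
      using \<open>\<epsilon> > 0\<close> unfolding uniformly_continuous_on_def by metis
    have "uniformly_continuous_on {a..b} (\<lambda>r. sqrt (p r))"
      by (intro compact_uniformly_continuous root_cont compact_Icc)
    then obtain d2 where "d2 > 0" and d2: "\<And>s r. s \<in> {a..b} \<Longrightarrow> r \<in> {a..b} \<Longrightarrow>
        dist r s < d2 \<Longrightarrow> dist (sqrt (p r)) (sqrt (p s)) < \<epsilon>"
      using \<open>\<epsilon> > 0\<close> unfolding uniformly_continuous_on_def by metis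
    define \<mu> where "\<mu> = density lborel (\<lambda>r. ennreal (\<bar>?w r\<bar> + \<epsilon> * H r))"
    have "ennreal \<bar>\<psi> b * sqrt (p b) - \<psi> a * sqrt (p a)\<bar> \<le> emeasure \<mu> {a<..b}"
    proof (rule increment_le_emeasure_from_local)
      show "sets \<mu> = sets borel" "a \<le> b" "min (d1 / 2) d2 > 0"
        using \<open>a \<le> b\<close> \<open>d1 > 0\<close> \<open>d2 > 0\<close> by (auto simp: \<mu>_def)
      fix s t assume st: "a \<le> s" "s \<le> t" "t \<le> b" "t - s < min (d1 / 2) d2"
      define X where "X r = K (s, t) * p' r + sqrt (p s) * \<psi>' r" for r
      have X_int: "set_integrable lborel {s..t} X"
        unfolding X_def using st by (intro set_integral_add set_integrable_mult_right p'_int \<psi>'_int)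
      have pos: "p s > 0" "p t > 0" using p_pos st by auto
      have "(LBINT r:{s..t}. X r) = K (s, t) * (p t - p s) + sqrt (p s) * (\<psi> t - \<psi> s)"
        unfolding X_def using st
        by (subst set_integral_add) (auto intro!: set_integrable_mult_right p'_int \<psi>'_int simp: p'_eq \<psi>'_eq)
      also have "p t - p s = (sqrt (p t) + sqrt (p s)) * (sqrt (p t) - sqrt (p s))"
        using pos by (simp add: algebra_simps)
      also have "K (s, t) * \<dots> = \<psi> t * (sqrt (p t) - sqrt (p s))"
        using root_sum[of t s] st by (simp add: K_def)
      finally have "\<psi> t * sqrt (p t) - \<psi> s * sqrt (p s) = (LBINT r:{s..t}. X r)"
        by (simp add: algebra_simps)
      then have "ennreal \<bar>\<psi> t * sqrt (p t) - \<psi> s * sqrt (p s)\<bar>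
          \<le> (\<integral>\<^sup>+r. ennreal \<bar>indicator {s..t} r *\<^sub>R X r\<bar> \<partial>lborel)"
        using integral_norm_bound_ennreal[OF X_int[unfolded set_integrable_def]]
        by (simp add: set_lebesgue_integral_def)
      also have "\<dots> \<le> (\<integral>\<^sup>+r\<in>{s<..t}. ennreal (\<bar>?w r\<bar> + \<epsilon> * H r) \<partial>lborel)"
      proof (rule nn_integral_mono_AE, rule eventually_mono[OF AE_lborel_singleton[of s]])
        fix r assume "r \<noteq> s"
        show "ennreal \<bar>indicator {s..t} r *\<^sub>R X r\<bar>
            \<le> ennreal (\<bar>?w r\<bar> + \<epsilon> * H r) * indicator {s<..t} r"
        proof (cases "r \<in> {s..t}")
          case True
          then have r: "r \<in> {a..b}" and rp: "p r > 0" using st p_pos by auto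
          have "dist (s, t) (r, r) \<le> dist s r + dist t r"
            unfolding dist_prod_def by (simp add: sqrt_sum_squares_le_sum)
          also have "\<dots> < d1"
            using True st by (auto simp: dist_real_def)
          finally have "dist (K (s, t)) (K (r, r)) < \<epsilon>"
            using st r by (intro d1) auto
          then have 1: "\<bar>K (s, t) - K (r, r)\<bar> \<le> \<epsilon>" by (simp add: dist_real_def)
          have "dist (sqrt (p s)) (sqrt (p r)) < \<epsilon>"
            using st r True by (intro d2) (auto simp: dist_real_def)
          then have 2: "\<bar>sqrt (p s) - sqrt (p r)\<bar> \<le> \<epsilon>" by (simp add: dist_real_def)
          have "X r = ?w r + (K (s, t) - K (r, r)) * p' r + (sqrt (p s) - sqrt (p r)) * \<psi>' r"
            by (simp add: X_def K_def algebra_simps)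
          also have "\<bar>\<dots>\<bar> \<le> \<bar>?w r\<bar> + \<bar>(K (s, t) - K (r, r)) * p' r\<bar> + \<bar>(sqrt (p s) - sqrt (p r)) * \<psi>' r\<bar>"
            by linarith
          also have "\<dots> \<le> \<bar>?w r\<bar> + \<epsilon> * \<bar>p' r\<bar> + \<epsilon> * \<bar>\<psi>' r\<bar>"
            unfolding abs_mult by (intro add_mono mult_right_mono 1 2) auto
          finally show ?thesis
            using True \<open>r \<noteq> s\<close> by (auto simp: H_def algebra_simps intro!: ennreal_leI)
        qed auto
      qed
      also have "\<dots> = emeasure \<mu> {s<..t}"
        unfolding \<mu>_def by (subst emeasure_density) auto
      finally show "ennreal \<bar>\<psi> t * sqrt (p t) - \<psi> s * sqrt (p s)\<bar> \<le> emeasure \<mu> {s<..t}" .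
    qed
    also have "\<dots> = (\<integral>\<^sup>+r\<in>{a<..b}. ennreal (\<bar>?w r\<bar> + \<epsilon> * H r) \<partial>lborel)"
      unfolding \<mu>_def by (subst emeasure_density) auto
    also have "\<dots> \<le> (\<integral>\<^sup>+r. ennreal \<bar>?w r\<bar> * indicator {a..b} r
        + ennreal \<epsilon> * (ennreal (H r) * indicator {a..b} r) \<partial>lborel)"
      using \<open>\<epsilon> > 0\<close>
      by (intro nn_integral_mono) (auto simp: ennreal_mult H_nonneg split: split_indicator)
    also have "\<dots> = (\<integral>\<^sup>+r\<in>{a..b}. ennreal \<bar>?w r\<bar> \<partial>lborel) + ennreal \<epsilon> * (\<integral>\<^sup>+r\<in>{a..b}. ennreal (H r) \<partial>lborel)"
      by (subst nn_integral_add) (auto simp: nn_integral_cmult)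
    finally show ?thesis .
  qed
  have "((\<lambda>\<epsilon>. (\<integral>\<^sup>+r\<in>{a..b}. ennreal \<bar>?w r\<bar> \<partial>lborel) + ennreal \<epsilon> * (\<integral>\<^sup>+r\<in>{a..b}. ennreal (H r) \<partial>lborel))
      \<longlongrightarrow> (\<integral>\<^sup>+r\<in>{a..b}. ennreal \<bar>?w r\<bar> \<partial>lborel) + ennreal 0 * (\<integral>\<^sup>+r\<in>{a..b}. ennreal (H r) \<partial>lborel)) (at_right 0)"
    using H_fin by (intro tendsto_intros ennreal_tendsto_cmult) auto
  then have "ennreal \<bar>\<psi> b * sqrt (p b) - \<psi> a * sqrt (p a)\<bar>
      \<le> (\<integral>\<^sup>+r\<in>{a..b}. ennreal \<bar>?w r\<bar> \<partial>lborel) + ennreal 0 * (\<integral>\<^sup>+r\<in>{a..b}. ennreal (H r) \<partial>lborel)"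
    by (rule tendsto_lowerbound)
       (auto simp: eventually_at_right_field intro!: exI[of _ 1] approx)
  then show ?thesis by simp
qed

text \<open>
  Stop at the last point \<open>d\<close> where \<open>g\<close> is at most the level \<open>g a + e\<close>. By the intermediate value
  theorem \<open>g d\<close> equals that level, which is positive, and so \<open>g\<close> is positive from \<open>d\<close> on. Nearly the
  whole rise of \<open>g\<close> therefore takes place on an interval free of zeros.
\<close>

lemma increment_le_across_zeros_upward:
  fixes g :: "real \<Rightarrow> real"
  assumes cont: "continuous_on {a..b} g" and "a \<le> b" and nonneg: "g a \<ge> 0" and "C \<ge> 0"
    and pos: "\<And>s. a \<le> s \<Longrightarrow> s \<le> b \<Longrightarrow> (\<And>y. y \<in> {s..b} \<Longrightarrow> g y > 0) \<Longrightarrow> g b - g s \<le> C"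
  shows "g b - g a \<le> C"
proof (rule field_le_epsilon)
  fix e :: real assume "e > 0"
  define l where "l = g a + e"
  show "g b - g a \<le> C + e"
  proof (cases "g b \<le> l")
    case True
    then show ?thesis using \<open>C \<ge> 0\<close> by (simp add: l_def)
  next
    case False
    define S where "S = {y \<in> {a..b}. g y \<in> {..l}}"
    have "closed S"
    proof -
      have "closed (g -` {..l} \<inter> {a..b})"
        using cont continuous_on_closed_vimage[of "{a..b}" g] by auto
      also have "g -` {..l} \<inter> {a..b} = S"
        by (auto simp: S_def)
      finally show ?thesis .
    qed
    moreover have "bounded S"
      by (rule bounded_subset[of "{a..b}"]) (auto simp: S_def)
    ultimately have "compact S"
      by (simp add: compact_eq_bounded_closed)
    have "a \<in> S"
      using \<open>a \<le> b\<close> \<open>e > 0\<close> by (simp add: S_def l_def)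
    with \<open>compact S\<close> obtain d where "d \<in> S" and d: "\<And>y. y \<in> S \<Longrightarrow> y \<le> d"
      using compact_attains_sup[of S] by blast
    then have dab: "a \<le> d" "d \<le> b" "g d \<le> l" by (auto simp: S_def)
    have "continuous_on {d..b} g"
      using dab by (intro continuous_on_subset[OF cont]) auto
    then obtain c where "d \<le> c" "c \<le> b" "g c = l"
      using IVT'[of g d l b] dab False by auto
    then have "g d = l"
      using d[of c] dab by (auto simp: S_def)
    have "g y > 0" if "y \<in> {d..b}" for y
    proof -
      have "g y \<ge> l"
        using d[of y] that dab \<open>g d = l\<close> by (cases "g y \<ge> l") (auto simp: S_def)
      then show ?thesis using nonneg \<open>e > 0\<close> by (simp add: l_def)
    qed
    then have "g b - g d \<le> C"
      using pos dab by blast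
    then show ?thesis using \<open>g d = l\<close> by (simp add: l_def)
  qed
qed

text \<open>
  A fall of \<open>g\<close> is a rise of its reflection.
\<close>

lemma abs_increment_le_across_zeros:
  fixes g :: "real \<Rightarrow> real"
  assumes cont: "continuous_on {a..b} g" and "a \<le> b" and "C \<ge> 0" and nonneg: "\<And>y. g y \<ge> 0"
    and pos: "\<And>s t. a \<le> s \<Longrightarrow> s \<le> t \<Longrightarrow> t \<le> b \<Longrightarrow> (\<And>y. y \<in> {s..t} \<Longrightarrow> g y > 0) \<Longrightarrow> \<bar>g t - g s\<bar> \<le> C"
  shows "\<bar>g b - g a\<bar> \<le> C"
proof -
  have "g b - g a \<le> C"
  proof (rule increment_le_across_zeros_upward[OF cont \<open>a \<le> b\<close> nonneg \<open>C \<ge> 0\<close>])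
    fix s assume "a \<le> s" "s \<le> b" and "\<And>y. y \<in> {s..b} \<Longrightarrow> g y > 0"
    then have "\<bar>g b - g s\<bar> \<le> C" by (intro pos) auto
    then show "g b - g s \<le> C" by simp
  qed
  moreover have "g (- (- a)) - g (- (- b)) \<le> C"
  proof (rule increment_le_across_zeros_upward[where g = "\<lambda>y. g (- y)"])
    show "continuous_on {- b..- a} (\<lambda>y. g (- y))"
      by (intro continuous_on_compose2[OF cont] continuous_intros) auto
    fix s assume s: "- b \<le> s" "s \<le> - a" and g: "\<And>y. y \<in> {s..- a} \<Longrightarrow> g (- y) > 0"
    have "g y > 0" if "y \<in> {a..- s}" for y
      using g[of "- y"] that by simp
    then have "\<bar>g (- s) - g a\<bar> \<le> C"
      using s by (intro pos) auto
    then show "g (- (- a)) - g (- s) \<le> C" by simp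
  qed (use \<open>a \<le> b\<close> \<open>C \<ge> 0\<close> nonneg in auto)
  ultimately show ?thesis by simp
qed

text \<open>
  The energy bound for increments, now also across zeros of \<open>p\<close>. The right-hand side can only grow with
  the interval, so its square root bounds the increments over all zero-free subintervals at once.
\<close>

lemma weighted_sqrt_increment_squared_le:
  fixes p p' \<psi> \<psi>' :: "real \<Rightarrow> real"
  assumes p': "has_Radon_Nikodym_derivative p p'"
    and p_cont: "continuous_on UNIV p" and p_nonneg: "\<And>y. p y \<ge> 0"
    and \<psi>: "\<And>y. (\<psi> has_real_derivative \<psi>' y) (at y)"
    and \<psi>'_cont: "continuous_on UNIV \<psi>'" and \<psi>_pos: "\<And>y. \<psi> y > 0"
    and "a \<le> b"
  defines "w \<equiv> (\<lambda>r. \<psi> r * p' r / (2 * sqrt (p r)) + \<psi>' r * sqrt (p r))"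
  shows "ennreal ((\<psi> b * sqrt (p b) - \<psi> a * sqrt (p a))\<^sup>2)
    \<le> ennreal (b - a) * (\<integral>\<^sup>+r\<in>{a..b}. ennreal ((w r)\<^sup>2) \<partial>lborel)"
    (is "_ \<le> ?R")
proof (cases "?R = \<infinity>")
  case True
  then show ?thesis by simp
next
  case False
  define C where "C = enn2real ?R"
  have R: "?R = ennreal C" and "C \<ge> 0"
    using False by (auto simp: C_def less_top)
  have \<psi>_cont: "continuous_on UNIV \<psi>"
    using \<psi> by (intro DERIV_continuous_on) (auto intro: has_field_derivative_at_within)
  note [measurable] = RN_derivative_borel_measurable[OF p']
    borel_measurable_continuous_onI[OF p_cont] borel_measurable_continuous_onI[OF \<psi>_cont]
    borel_measurable_continuous_onI[OF \<psi>'_cont]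
  have [measurable]: "w \<in> borel_measurable borel"
    unfolding w_def by measurable
  have "\<bar>\<psi> b * sqrt (p b) - \<psi> a * sqrt (p a)\<bar> \<le> sqrt C"
  proof (rule abs_increment_le_across_zeros[where g = "\<lambda>y. \<psi> y * sqrt (p y)"])
    show "continuous_on {a..b} (\<lambda>y. \<psi> y * sqrt (p y))"
      by (intro continuous_intros continuous_on_subset[OF p_cont] continuous_on_subset[OF \<psi>_cont]) auto
    show "0 \<le> \<psi> y * sqrt (p y)" for y
      using p_nonneg[of y] \<psi>_pos[of y] by simp
    fix s t assume st: "a \<le> s" "s \<le> t" "t \<le> b"
      and pos: "\<And>y. y \<in> {s..t} \<Longrightarrow> 0 < \<psi> y * sqrt (p y)"
    have p_pos: "p y > 0" if "y \<in> {s..t}" for y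
      using pos[OF that] \<psi>_pos[of y] by (simp add: zero_less_mult_iff)
    have "ennreal (\<bar>\<psi> t * sqrt (p t) - \<psi> s * sqrt (p s)\<bar>\<^sup>2)
        = (ennreal \<bar>\<psi> t * sqrt (p t) - \<psi> s * sqrt (p s)\<bar>)\<^sup>2"
      by (simp add: ennreal_power)
    also have "\<dots> \<le> (\<integral>\<^sup>+r\<in>{s..t}. ennreal \<bar>w r\<bar> \<partial>lborel)\<^sup>2"
      unfolding w_def
      by (intro power_mono abs_weighted_sqrt_increment_le[OF p' p_cont \<psi> \<psi>'_cont \<open>s \<le> t\<close> p_pos]) auto
    also have "\<dots> = (\<integral>\<^sup>+r. indicator {s..t} r * (ennreal \<bar>w r\<bar> * indicator {s..t} r) \<partial>lborel)\<^sup>2"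
      by (intro arg_cong[where f = "\<lambda>x. x\<^sup>2"] nn_integral_cong) (simp split: split_indicator)
    also have "\<dots> \<le> (\<integral>\<^sup>+r. (indicator {s..t} r)\<^sup>2 \<partial>lborel) * (\<integral>\<^sup>+r. (ennreal \<bar>w r\<bar> * indicator {s..t} r)\<^sup>2 \<partial>lborel)"
      by (intro Cauchy_Schwarz_nn_integral) measurable
    also have "(\<integral>\<^sup>+r. (indicator {s..t} r)\<^sup>2 \<partial>lborel) = (\<integral>\<^sup>+r. indicator {s..t} r \<partial>lborel)"
      by (intro nn_integral_cong) (simp split: split_indicator)
    also have "\<dots> = ennreal (t - s)"
      using st by simp
    also have "(\<integral>\<^sup>+r. (ennreal \<bar>w r\<bar> * indicator {s..t} r)\<^sup>2 \<partial>lborel) = (\<integral>\<^sup>+r\<in>{s..t}. ennreal ((w r)\<^sup>2) \<partial>lborel)"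
      by (intro nn_integral_cong) (simp add: ennreal_power split: split_indicator)
    also have "ennreal (t - s) * \<dots> \<le> ?R"
      using st by (intro mult_mono ennreal_leI nn_integral_mono) (auto split: split_indicator)
    finally have "\<bar>\<psi> t * sqrt (p t) - \<psi> s * sqrt (p s)\<bar>\<^sup>2 \<le> C"
      unfolding R using \<open>C \<ge> 0\<close> by (simp add: ennreal_le_iff)
    then show "\<bar>\<psi> t * sqrt (p t) - \<psi> s * sqrt (p s)\<bar> \<le> sqrt C"
      by (rule real_le_rsqrt)
  qed (use \<open>a \<le> b\<close> \<open>C \<ge> 0\<close> in auto)
  then have "\<bar>\<psi> b * sqrt (p b) - \<psi> a * sqrt (p a)\<bar>\<^sup>2 \<le> (sqrt C)\<^sup>2"
    by (intro power_mono) auto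
  then have "(\<psi> b * sqrt (p b) - \<psi> a * sqrt (p a))\<^sup>2 \<le> C"
    using \<open>C \<ge> 0\<close> by simp
  then show ?thesis
    unfolding R by (intro ennreal_leI)
qed

section \<open>The Gaussian Poincare inequality in two-point form\<close>

lemma integrable_std_normal_density_times: "integrable lborel (\<lambda>y. y * std_normal_density y)"
  using integrable_std_normal_moment[of 1] by (simp add: mult.commute)

text \<open>
  The derivative of \<open>- \<phi>\<close> is \<open>y \<phi> y\<close>, and \<open>\<phi>\<close> vanishes at infinity.
\<close>

lemma std_normal_upper_first_moment:
  "(LBINT y:{s..}. y * std_normal_density y) = std_normal_density s"
proof -
  have int: "set_integrable lborel A (\<lambda>y. y * std_normal_density y)" if "A \<in> sets borel" for A
    unfolding set_integrable_def
    using integrable_mult_indicator[OF _ integrable_std_normal_density_times, of A] that by simp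
  have "(LBINT y:{s..t}. y * std_normal_density y) = std_normal_density s - std_normal_density t"
    if "s \<le> t" for t
  proof -
    have "(\<integral>y. (y * std_normal_density y) * indicator {s..t} y \<partial>lborel)
        = - std_normal_density t - (- std_normal_density s)"
    proof (rule integral_FTC_Icc_real[OF that])
      fix y :: real
      show "((\<lambda>y. - std_normal_density y) has_real_derivative y * std_normal_density y) (at y)"
        unfolding std_normal_density_def by (rule derivative_eq_intros refl | simp)+
      show "isCont (\<lambda>y. y * std_normal_density y) y"
        unfolding std_normal_density_def by (intro continuous_intros) auto
    qed
    then show ?thesis by (simp add: set_lebesgue_integral_def mult.commute)
  qed
  then have "\<forall>\<^sub>F t in at_top. (LBINT y:{s..t}. y * std_normal_density y)
      = std_normal_density s - std_normal_density t"
    by (intro eventually_at_top_linorderI[of s]) auto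
  moreover have "((\<lambda>t. LBINT y:{s..t}. y * std_normal_density y)
      \<longlongrightarrow> (LBINT y:{s..}. y * std_normal_density y)) at_top"
    by (intro tendsto_set_lebesgue_integral_at_top int) auto
  ultimately have lim: "((\<lambda>t. std_normal_density s - std_normal_density t)
      \<longlongrightarrow> (LBINT y:{s..}. y * std_normal_density y)) at_top"
    by (rule Lim_transform_eventually[rotated])
  have "(std_normal_density \<longlongrightarrow> 0) at_top"
  proof -
    have "filterlim (\<lambda>y::real. y\<^sup>2 * (1 / 2)) at_top at_top"
      by (intro filterlim_at_top_mult_tendsto_pos[OF tendsto_const] filterlim_pow_at_top filterlim_ident) auto
    then have "filterlim (\<lambda>y::real. - y\<^sup>2 / 2) at_bot at_top"
      by (simp add: filterlim_uminus_at_bot)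
    then have "((\<lambda>y::real. exp (- y\<^sup>2 / 2)) \<longlongrightarrow> 0) at_top"
      by (rule filterlim_compose[OF exp_at_bot])
    then show ?thesis
      unfolding std_normal_density_def by (rule tendsto_mult_right_zero)
  qed
  then have lim': "((\<lambda>t. std_normal_density s - std_normal_density t) \<longlongrightarrow> std_normal_density s - 0) at_top"
    by (intro tendsto_intros)
  show ?thesis
    using tendsto_unique[OF trivial_limit_at_top_linorder lim lim'] by simp
qed

text \<open>
  With \<open>U\<close> and \<open>L\<close> the masses of \<open>\<phi>\<close> above and below \<open>s\<close>, the first moments above and below \<open>s\<close> are
  \<open>\<phi> s\<close> and \<open>- \<phi> s\<close>, the mean being \<open>0\<close>. Integrating over \<open>b\<close> and then over \<open>a\<close> gives
  \<open>\<phi> s L + U \<phi> s\<close>, and \<open>L + U = 1\<close>. For a general density this double integral is the density times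
  its Stein kernel; the Stein kernel of the standard normal law is the constant \<open>1\<close>.
\<close>

lemma std_normal_straddling_gap:
  fixes s :: real
  shows "(\<integral>\<^sup>+a. \<integral>\<^sup>+b. ennreal (if a \<le> s \<and> s \<le> b
      then (b - a) * std_normal_density a * std_normal_density b else 0) \<partial>lborel \<partial>lborel)
    = ennreal (std_normal_density s)"
proof -
  let ?\<phi> = std_normal_density
  define U where "U = (LBINT y:{s..}. ?\<phi> y)"
  define L where "L = (LBINT y:{..s}. ?\<phi> y)"
  have phi_int: "integrable lborel ?\<phi>" and phi_total: "(\<integral>y. ?\<phi> y \<partial>lborel) = 1"
    using integrable_normal_density[of 1 0] integral_normal_density[of 1 0] by auto
  have int0: "set_integrable lborel A ?\<phi>" if "A \<in> sets borel" for A
    unfolding set_integrable_def using integrable_mult_indicator[OF _ phi_int, of A] that by simp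
  have int1: "set_integrable lborel A (\<lambda>y. y * ?\<phi> y)" if "A \<in> sets borel" for A
    unfolding set_integrable_def
    using integrable_mult_indicator[OF _ integrable_std_normal_density_times, of A] that by simp
  have split: "(LBINT y:{..s}. f y) + (LBINT y:{s..}. f y) = (\<integral>y. f y \<partial>lborel)"
    if f: "integrable lborel f" for f :: "real \<Rightarrow> real"
  proof -
    have "(\<integral>y. f y \<partial>lborel) = (\<integral>y. indicator {..s} y *\<^sub>R f y + indicator {s..} y *\<^sub>R f y \<partial>lborel)"
      using f by (intro integral_cong_AE)
         (auto intro!: eventually_mono[OF AE_lborel_singleton[of s]] split: split_indicator)
    also have "\<dots> = (LBINT y:{..s}. f y) + (LBINT y:{s..}. f y)"
      unfolding set_lebesgue_integral_def
      by (intro Bochner_Integration.integral_add integrable_mult_indicator f) auto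
    finally show ?thesis by simp
  qed
  have "L + U = 1"
    unfolding L_def U_def using split[OF phi_int] phi_total by simp
  have low: "(LBINT y:{..s}. y * ?\<phi> y) = - ?\<phi> s"
    using split[OF integrable_std_normal_density_times] std_normal_upper_first_moment[of s]
      integral_std_normal_moment_odd[of 0] by (simp add: mult.commute)
  have inner: "(\<integral>\<^sup>+b. ennreal (indicator {..s} a * indicator {s..} b * (b - a) * ?\<phi> a * ?\<phi> b) \<partial>lborel)
      = ennreal (indicator {..s} a * (?\<phi> s * ?\<phi> a - U * (a * ?\<phi> a)))"
    and inner_nonneg: "0 \<le> indicator {..s} a * (?\<phi> s * ?\<phi> a - U * (a * ?\<phi> a))" for a
  proof -
    define h where "h b = indicator {..s} a * ?\<phi> a
      * (indicator {s..} b *\<^sub>R (b * ?\<phi> b) - a * (indicator {s..} b *\<^sub>R ?\<phi> b))" for b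
    have h_eq: "indicator {..s} a * indicator {s..} b * (b - a) * ?\<phi> a * ?\<phi> b = h b" for b
      by (simp add: h_def algebra_simps)
    have h_nonneg: "0 \<le> h b" for b
      unfolding h_eq[symmetric] by (auto split: split_indicator)
    have j1: "integrable lborel (\<lambda>b. indicator {s..} b *\<^sub>R (b * ?\<phi> b))"
      and j0: "integrable lborel (\<lambda>b. a * (indicator {s..} b *\<^sub>R ?\<phi> b))"
      by (intro integrable_mult_right int0[unfolded set_integrable_def] int1[unfolded set_integrable_def];
          simp)+
    have h_int: "integrable lborel h"
      unfolding h_def by (intro integrable_mult_right Bochner_Integration.integrable_diff[OF j1 j0])
    have "(\<integral>b. h b \<partial>lborel) = indicator {..s} a * ?\<phi> a * (?\<phi> s - a * U)"
      unfolding h_def integral_mult_right_zero Bochner_Integration.integral_diff[OF j1 j0]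
      by (simp only: U_def std_normal_upper_first_moment[of s, symmetric] set_lebesgue_integral_def)
    then have eq: "(\<integral>b. h b \<partial>lborel) = indicator {..s} a * (?\<phi> s * ?\<phi> a - U * (a * ?\<phi> a))"
      by (simp add: algebra_simps)
    show "(\<integral>\<^sup>+b. ennreal (indicator {..s} a * indicator {s..} b * (b - a) * ?\<phi> a * ?\<phi> b) \<partial>lborel)
      = ennreal (indicator {..s} a * (?\<phi> s * ?\<phi> a - U * (a * ?\<phi> a)))"
      unfolding h_eq eq[symmetric] by (intro nn_integral_eq_integral h_int) (simp add: h_nonneg)
    show "0 \<le> indicator {..s} a * (?\<phi> s * ?\<phi> a - U * (a * ?\<phi> a))"
      unfolding eq[symmetric] by (intro integral_nonneg_AE) (simp add: h_nonneg)
  qed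
  define k where "k a = ?\<phi> s * (indicator {..s} a *\<^sub>R ?\<phi> a) - U * (indicator {..s} a *\<^sub>R (a * ?\<phi> a))" for a
  have k_eq: "indicator {..s} a * (?\<phi> s * ?\<phi> a - U * (a * ?\<phi> a)) = k a" for a
    by (simp add: k_def algebra_simps)
  have i0: "integrable lborel (\<lambda>a. ?\<phi> s * (indicator {..s} a *\<^sub>R ?\<phi> a))"
    and i1: "integrable lborel (\<lambda>a. U * (indicator {..s} a *\<^sub>R (a * ?\<phi> a)))"
    by (intro integrable_mult_right int0[unfolded set_integrable_def] int1[unfolded set_integrable_def];
        simp)+
  have k_int: "integrable lborel k"
    unfolding k_def by (rule Bochner_Integration.integrable_diff[OF i0 i1])
  have "(\<integral>\<^sup>+a. ennreal (k a) \<partial>lborel) = ennreal (\<integral>a. k a \<partial>lborel)"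
    using inner_nonneg by (intro nn_integral_eq_integral k_int) (simp add: k_eq)
  also have "(\<integral>a. k a \<partial>lborel) = ?\<phi> s * L - U * (- ?\<phi> s)"
    unfolding k_def Bochner_Integration.integral_diff[OF i0 i1] integral_mult_right_zero
    by (simp only: L_def low[symmetric] set_lebesgue_integral_def)
  also have "\<dots> = ?\<phi> s"
  proof -
    have "?\<phi> s * L - U * (- ?\<phi> s) = ?\<phi> s * (L + U)"
      by (simp add: algebra_simps)
    then show ?thesis using \<open>L + U = 1\<close> by simp
  qed
  finally have "(\<integral>\<^sup>+a. \<integral>\<^sup>+b. ennreal (indicator {..s} a * indicator {s..} b * (b - a)
      * ?\<phi> a * ?\<phi> b) \<partial>lborel \<partial>lborel) = ennreal (?\<phi> s)"
    by (simp add: inner k_eq)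
  moreover have "indicator {..s} a * indicator {s..} b * (b - a) * ?\<phi> a * ?\<phi> b
      = (if a \<le> s \<and> s \<le> b then (b - a) * ?\<phi> a * ?\<phi> b else 0)" for a b
    by (simp add: indicator_def)
  ultimately show ?thesis by simp
qed

text \<open>
  The left-hand side is twice the variance of \<open>g\<close> when \<open>g\<close> is square integrable. The function \<open>G\<close>
  stands for \<open>g'\<^sup>2\<close>; all that is required of it is the bound on increments that Cauchy--Schwarz gives
  for a function with derivative \<open>g'\<close>. All integrands are nonnegative, so the integrals may be
  exchanged even if the energy is infinite.
\<close>

lemma std_normal_two_point_Poincare:
  fixes g :: "real \<Rightarrow> real" and G :: "real \<Rightarrow> ennreal"
  assumes [measurable]: "G \<in> borel_measurable borel"
    and incr: "\<And>a b. a \<le> b \<Longrightarrow>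
      ennreal ((g b - g a)\<^sup>2) \<le> ennreal (b - a) * (\<integral>\<^sup>+s\<in>{a..b}. G s \<partial>lborel)"
  shows "(\<integral>\<^sup>+a. \<integral>\<^sup>+b. ennreal ((g b - g a)\<^sup>2 * std_normal_density a * std_normal_density b) \<partial>lborel \<partial>lborel)
    \<le> 2 * (\<integral>\<^sup>+s. G s * ennreal (std_normal_density s) \<partial>lborel)"
proof -
  let ?\<phi> = std_normal_density
  define k where "k s a b = ennreal (if a \<le> s \<and> s \<le> b then (b - a) * ?\<phi> a * ?\<phi> b else 0)" for s a b
  have kG_meas: "(\<lambda>(s, b). k s a b * G s) \<in> borel_measurable (lborel \<Otimes>\<^sub>M lborel)" for a
    unfolding k_def by measurable
  have kG_meas': "(\<lambda>(s, a). \<integral>\<^sup>+b. k s a b * G s \<partial>lborel) \<in> borel_measurable (lborel \<Otimes>\<^sub>M lborel)"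
    unfolding k_def by measurable
  define T where "T a b = (\<integral>\<^sup>+s. k s a b * G s \<partial>lborel)" for a b
  have T_meas [measurable]: "(\<lambda>(a, b). T a b) \<in> borel_measurable (lborel \<Otimes>\<^sub>M lborel)"
    unfolding T_def k_def by measurable
  have T_eq: "T a b = ennreal (?\<phi> a * ?\<phi> b) * (ennreal (b - a) * (\<integral>\<^sup>+s\<in>{a..b}. G s \<partial>lborel))" if "a \<le> b" for a b
  proof -
    have "T a b = (\<integral>\<^sup>+s. ennreal ((b - a) * ?\<phi> a * ?\<phi> b) * (G s * indicator {a..b} s) \<partial>lborel)"
      unfolding T_def k_def by (intro nn_integral_cong) (simp add: indicator_def)
    also have "\<dots> = ennreal ((b - a) * ?\<phi> a * ?\<phi> b) * (\<integral>\<^sup>+s\<in>{a..b}. G s \<partial>lborel)"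
      by (intro nn_integral_cmult) simp
    also have "ennreal ((b - a) * ?\<phi> a * ?\<phi> b) = ennreal (?\<phi> a * ?\<phi> b) * ennreal (b - a)"
      using that by (subst ennreal_mult[symmetric]) (auto simp: mult_ac)
    finally show ?thesis by (simp add: mult_ac)
  qed
  have increment_le: "ennreal ((g b - g a)\<^sup>2 * ?\<phi> a * ?\<phi> b) \<le> T a b" if "a \<le> b" for a b
  proof -
    have "ennreal ((g b - g a)\<^sup>2 * ?\<phi> a * ?\<phi> b) = ennreal (?\<phi> a * ?\<phi> b) * ennreal ((g b - g a)\<^sup>2)"
      by (subst ennreal_mult[symmetric]) (auto simp: mult_ac)
    also have "\<dots> \<le> T a b"
      unfolding T_eq[OF that] by (intro mult_left_mono incr that) simp
    finally show ?thesis .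
  qed
  have "ennreal ((g b - g a)\<^sup>2 * ?\<phi> a * ?\<phi> b) \<le> T a b + T b a" for a b
  proof (cases "a \<le> b")
    case True
    then show ?thesis using increment_le[of a b] by (simp add: add_increasing2)
  next
    case False
    then have "ennreal ((g b - g a)\<^sup>2 * ?\<phi> a * ?\<phi> b) \<le> T b a"
      using increment_le[of b a] by (simp add: power2_commute mult_ac)
    then show ?thesis by (simp add: add_increasing)
  qed
  then have "(\<integral>\<^sup>+a. \<integral>\<^sup>+b. ennreal ((g b - g a)\<^sup>2 * ?\<phi> a * ?\<phi> b) \<partial>lborel \<partial>lborel)
      \<le> (\<integral>\<^sup>+a. \<integral>\<^sup>+b. T a b + T b a \<partial>lborel \<partial>lborel)"
    by (intro nn_integral_mono)
  also have "\<dots> = (\<integral>\<^sup>+a. (\<integral>\<^sup>+b. T a b \<partial>lborel) + (\<integral>\<^sup>+b. T b a \<partial>lborel) \<partial>lborel)"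
    by (intro nn_integral_cong nn_integral_add) measurable
  also have "\<dots> = (\<integral>\<^sup>+a. \<integral>\<^sup>+b. T a b \<partial>lborel \<partial>lborel) + (\<integral>\<^sup>+a. \<integral>\<^sup>+b. T b a \<partial>lborel \<partial>lborel)"
    by (intro nn_integral_add) measurable
  also have "(\<integral>\<^sup>+a. \<integral>\<^sup>+b. T b a \<partial>lborel \<partial>lborel) = (\<integral>\<^sup>+a. \<integral>\<^sup>+b. T a b \<partial>lborel \<partial>lborel)"
    using lborel_pair.Fubini'[of "\<lambda>a b. T a b"] by simp
  also have "(\<integral>\<^sup>+a. \<integral>\<^sup>+b. T a b \<partial>lborel \<partial>lborel) = (\<integral>\<^sup>+a. \<integral>\<^sup>+s. \<integral>\<^sup>+b. k s a b * G s \<partial>lborel \<partial>lborel \<partial>lborel)"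
    unfolding T_def by (intro nn_integral_cong lborel_pair.Fubini'[OF kG_meas])
  also have "\<dots> = (\<integral>\<^sup>+s. \<integral>\<^sup>+a. \<integral>\<^sup>+b. k s a b * G s \<partial>lborel \<partial>lborel \<partial>lborel)"
    by (rule lborel_pair.Fubini'[OF kG_meas'])
  also have "\<dots> = (\<integral>\<^sup>+s. (\<integral>\<^sup>+a. \<integral>\<^sup>+b. k s a b \<partial>lborel \<partial>lborel) * G s \<partial>lborel)"
    unfolding k_def by (simp add: nn_integral_multc)
  also have "\<dots> = (\<integral>\<^sup>+s. G s * ennreal (?\<phi> s) \<partial>lborel)"
    unfolding k_def by (simp add: std_normal_straddling_gap mult.commute)
  finally show ?thesis by (simp add: mult_2)
qed

section \<open>Affinity and Hellinger distance of two densities\<close>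

lemma
  fixes f g :: "'a \<Rightarrow> real"
  assumes [measurable]: "f \<in> borel_measurable M" "g \<in> borel_measurable M"
    and f2: "integrable M (\<lambda>x. (f x)\<^sup>2)" and g2: "integrable M (\<lambda>x. (g x)\<^sup>2)"
    and f0: "\<And>x. 0 \<le> f x" and g0: "\<And>x. 0 \<le> g x"
  shows integrable_mult_of_squares: "integrable M (\<lambda>x. f x * g x)"
    and integral_mult_le_sqrt_integrals: "(\<integral>x. f x * g x \<partial>M) \<le> sqrt (\<integral>x. (f x)\<^sup>2 \<partial>M) * sqrt (\<integral>x. (g x)\<^sup>2 \<partial>M)"
proof -
  show fg: "integrable M (\<lambda>x. f x * g x)"
  proof (rule Bochner_Integration.integrable_bound)
    show "integrable M (\<lambda>x. (f x)\<^sup>2 + (g x)\<^sup>2)" using f2 g2 by simp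
    have "f x * g x \<le> (f x)\<^sup>2 + (g x)\<^sup>2" for x
      using sum_squares_bound[of "f x" "g x"] f0[of x] g0[of x] mult_nonneg_nonneg[of "f x" "g x"] by linarith
    then show "AE x in M. norm (f x * g x) \<le> norm ((f x)\<^sup>2 + (g x)\<^sup>2)"
      using f0 g0 by (simp add: abs_mult)
  qed simp
  have "ennreal ((\<integral>x. f x * g x \<partial>M)\<^sup>2) = (\<integral>\<^sup>+x. ennreal (f x) * ennreal (g x) \<partial>M)\<^sup>2"
    using f0 g0 nn_integral_eq_integral[OF fg]
    by (simp add: ennreal_mult ennreal_power[symmetric] integral_nonneg_AE)
  also have "\<dots> \<le> (\<integral>\<^sup>+x. ennreal (f x) ^ 2 \<partial>M) * (\<integral>\<^sup>+x. ennreal (g x) ^ 2 \<partial>M)"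
    by (intro Cauchy_Schwarz_nn_integral) measurable
  also have "\<dots> = ennreal ((\<integral>x. (f x)\<^sup>2 \<partial>M) * (\<integral>x. (g x)\<^sup>2 \<partial>M))"
    using nn_integral_eq_integral[OF f2] nn_integral_eq_integral[OF g2] f0 g0
    by (simp add: ennreal_power ennreal_mult)
  finally have "(\<integral>x. f x * g x \<partial>M)\<^sup>2 \<le> (\<integral>x. (f x)\<^sup>2 \<partial>M) * (\<integral>x. (g x)\<^sup>2 \<partial>M)"
    by (subst (asm) ennreal_le_iff) (auto intro!: mult_nonneg_nonneg)
  then show "(\<integral>x. f x * g x \<partial>M) \<le> sqrt (\<integral>x. (f x)\<^sup>2 \<partial>M) * sqrt (\<integral>x. (g x)\<^sup>2 \<partial>M)"
    unfolding real_sqrt_mult[symmetric] by (rule real_le_rsqrt)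
qed

locale density_pair =
  fixes M :: "'a measure" and p q :: "'a \<Rightarrow> real"
  assumes p_int: "integrable M p" and q_int: "integrable M q"
    and p_total: "(\<integral>x. p x \<partial>M) = 1" and q_total: "(\<integral>x. q x \<partial>M) = 1"
    and p_nonneg: "\<And>x. 0 \<le> p x" and q_nonneg: "\<And>x. 0 \<le> q x"
begin

text \<open>
  The Bhattacharyya coefficient.
\<close>

definition affinity :: real where
  "affinity = (\<integral>x. sqrt (p x) * sqrt (q x) \<partial>M)"

lemma measurable_densities [measurable]: "p \<in> borel_measurable M" "q \<in> borel_measurable M"
  using p_int q_int by auto

lemma integrable_affinity: "integrable M (\<lambda>x. sqrt (p x) * sqrt (q x))"
proof (rule Bochner_Integration.integrable_bound)
  show "integrable M (\<lambda>x. p x + q x)" using p_int q_int by simp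
  have "sqrt (p x) * sqrt (q x) \<le> p x + q x" for x
    using arith_geo_mean_sqrt[OF p_nonneg q_nonneg, of x x] p_nonneg[of x] q_nonneg[of x]
    by (simp add: real_sqrt_mult)
  then show "AE x in M. norm (sqrt (p x) * sqrt (q x)) \<le> norm (p x + q x)"
    using p_nonneg q_nonneg by (simp add: abs_mult)
qed simp

lemma affinity_nonneg: "0 \<le> affinity"
  unfolding affinity_def using p_nonneg q_nonneg by (intro integral_nonneg_AE) simp

lemma sqrt_diff_squared: "(sqrt (p x) - sqrt (q x))\<^sup>2 = p x + q x - 2 * (sqrt (p x) * sqrt (q x))"
  using p_nonneg[of x] q_nonneg[of x] by (simp add: power2_diff)

lemma integrable_sqrt_diff_squared: "integrable M (\<lambda>x. (sqrt (p x) - sqrt (q x))\<^sup>2)"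
  unfolding sqrt_diff_squared using p_int q_int integrable_affinity by simp

lemma Hellinger_eq: "(\<integral>x. (sqrt (p x) - sqrt (q x))\<^sup>2 \<partial>M) = 2 - 2 * affinity"
  unfolding sqrt_diff_squared affinity_def
  using p_int q_int integrable_affinity p_total q_total by simp

lemma affinity_le_1: "affinity \<le> 1"
proof -
  have "0 \<le> (\<integral>x. (sqrt (p x) - sqrt (q x))\<^sup>2 \<partial>M)"
    by (intro integral_nonneg_AE) simp
  then show ?thesis by (simp add: Hellinger_eq)
qed

text \<open>
  Cauchy--Schwarz, applied separately to the two summands of
  \<open>p - q = (sqrt p - sqrt q) sqrt p + (sqrt p - sqrt q) sqrt q\<close> restricted to \<open>A\<close>.
\<close>

lemma event_difference_le_Hellinger:
  assumes A [measurable]: "A \<in> sets M"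
  shows "\<bar>(LINT x:A|M. p x) - (LINT x:A|M. q x)\<bar>
    \<le> sqrt (2 - 2 * affinity) * (sqrt (LINT x:A|M. p x) + sqrt (LINT x:A|M. q x))"
proof -
  let ?d = "\<lambda>x. \<bar>sqrt (p x) - sqrt (q x)\<bar>"
  have bound: "integrable M (\<lambda>x. ?d x * (indicator A x * sqrt (u x)))"
      "(\<integral>x. ?d x * (indicator A x * sqrt (u x)) \<partial>M) \<le> sqrt (2 - 2 * affinity) * sqrt (LINT x:A|M. u x)"
    if u: "integrable M u" "\<And>x. 0 \<le> u x" for u
  proof -
    have [measurable]: "u \<in> borel_measurable M" using u(1) by auto
    have sq: "(indicator A x * sqrt (u x))\<^sup>2 = indicator A x *\<^sub>R u x" for x
      using u(2)[of x] by (simp add: indicator_def)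
    have int: "integrable M (\<lambda>x. (indicator A x * sqrt (u x))\<^sup>2)"
      unfolding sq by (intro integrable_mult_indicator u A)
    have "(\<integral>x. ?d x * (indicator A x * sqrt (u x)) \<partial>M)
        \<le> sqrt (\<integral>x. (?d x)\<^sup>2 \<partial>M) * sqrt (\<integral>x. (indicator A x * sqrt (u x))\<^sup>2 \<partial>M)"
      using integrable_sqrt_diff_squared int u(2)
      by (intro integral_mult_le_sqrt_integrals) auto
    then show "(\<integral>x. ?d x * (indicator A x * sqrt (u x)) \<partial>M) \<le> sqrt (2 - 2 * affinity) * sqrt (LINT x:A|M. u x)"
      unfolding sq by (simp add: Hellinger_eq set_lebesgue_integral_def)
    show "integrable M (\<lambda>x. ?d x * (indicator A x * sqrt (u x)))"
      using integrable_sqrt_diff_squared int u(2)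
      by (intro integrable_mult_of_squares) auto
  qed
  have setint: "integrable M (\<lambda>x. indicator A x *\<^sub>R p x)" "integrable M (\<lambda>x. indicator A x *\<^sub>R q x)"
    by (intro integrable_mult_indicator p_int q_int A)+
  have "\<bar>(LINT x:A|M. p x) - (LINT x:A|M. q x)\<bar> = \<bar>\<integral>x. indicator A x *\<^sub>R p x - indicator A x *\<^sub>R q x \<partial>M\<bar>"
    unfolding set_lebesgue_integral_def using setint by simp
  also have "\<dots> \<le> (\<integral>x. \<bar>indicator A x *\<^sub>R p x - indicator A x *\<^sub>R q x\<bar> \<partial>M)"
    by (rule integral_abs_bound)
  also have "\<dots> = (\<integral>x. ?d x * (indicator A x * sqrt (p x)) + ?d x * (indicator A x * sqrt (q x)) \<partial>M)"
  proof (intro Bochner_Integration.integral_cong refl)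
    fix x
    have "p x - q x = (sqrt (p x) - sqrt (q x)) * (sqrt (p x) + sqrt (q x))"
      using p_nonneg[of x] q_nonneg[of x] by (simp add: algebra_simps)
    then have "\<bar>p x - q x\<bar> = ?d x * (sqrt (p x) + sqrt (q x))"
      using p_nonneg[of x] q_nonneg[of x] by (simp add: abs_mult)
    then show "\<bar>indicator A x *\<^sub>R p x - indicator A x *\<^sub>R q x\<bar>
        = ?d x * (indicator A x * sqrt (p x)) + ?d x * (indicator A x * sqrt (q x))"
      by (simp add: indicator_def distrib_left)
  qed
  also have "\<dots> \<le> sqrt (2 - 2 * affinity) * sqrt (LINT x:A|M. p x) + sqrt (2 - 2 * affinity) * sqrt (LINT x:A|M. q x)"
    using bound[OF p_int p_nonneg] bound[OF q_int q_nonneg]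
    by (subst Bochner_Integration.integral_add) (auto intro: add_mono)
  finally show ?thesis by (simp add: distrib_left)
qed

text \<open>
  Twice the variance of \<open>g = sqrt (p / q)\<close> under the law with density \<open>q\<close>: expand the square, noting that
  \<open>g\<^sup>2 q = p\<close> and \<open>g q = sqrt p sqrt q\<close>.
\<close>

lemma two_point_integral_sqrt_ratio:
  assumes q_pos: "\<And>x. 0 < q x"
  defines "g \<equiv> (\<lambda>x. 1 / sqrt (q x) * sqrt (p x))"
  shows "(\<integral>\<^sup>+a. \<integral>\<^sup>+b. ennreal ((g b - g a)\<^sup>2 * q a * q b) \<partial>M \<partial>M) = ennreal (2 - 2 * affinity\<^sup>2)"
proof -
  let ?r = "\<lambda>x. sqrt (p x) * sqrt (q x)"
  have g2: "(g x)\<^sup>2 * q x = p x" and g1: "g x * q x = ?r x" for x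
    using q_pos[of x] p_nonneg[of x] real_sqrt_pow2[of "q x"]
    by (auto simp: g_def power_mult_distrib power_divide field_simps simp flip: power2_eq_square)
  have expand: "(g b - g a)\<^sup>2 * q a * q b = q a * p b + p a * q b - 2 * ?r a * ?r b" for a b
  proof -
    have "(g b - g a)\<^sup>2 * q a * q b
        = q a * ((g b)\<^sup>2 * q b) + ((g a)\<^sup>2 * q a) * q b - 2 * (g a * q a) * (g b * q b)"
      by (simp add: power2_eq_square algebra_simps)
    then show ?thesis by (simp only: g1 g2)
  qed
  have nonneg: "0 \<le> q a * p b + p a * q b - 2 * ?r a * ?r b" for a b
    unfolding expand[symmetric] by (intro mult_nonneg_nonneg q_nonneg) simp
  have eq: "(\<integral>b. q a * p b + p a * q b - 2 * ?r a * ?r b \<partial>M) = q a + p a - 2 * ?r a * affinity" for a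
    unfolding affinity_def using p_int q_int integrable_affinity p_total q_total by simp
  have inner: "(\<integral>\<^sup>+b. ennreal (q a * p b + p a * q b - 2 * ?r a * ?r b) \<partial>M)
      = ennreal (q a + p a - 2 * ?r a * affinity)" for a
    unfolding eq[symmetric] using nonneg p_int q_int integrable_affinity
    by (intro nn_integral_eq_integral) auto
  have inner_nonneg: "0 \<le> q a + p a - 2 * ?r a * affinity" for a
    unfolding eq[symmetric] using nonneg by (intro integral_nonneg_AE) simp
  have "(\<integral>\<^sup>+a. ennreal (q a + p a - 2 * ?r a * affinity) \<partial>M)
      = ennreal (\<integral>a. q a + p a - 2 * ?r a * affinity \<partial>M)"
    using inner_nonneg p_int q_int integrable_affinity by (intro nn_integral_eq_integral) auto
  also have "(\<integral>a. q a + p a - 2 * ?r a * affinity \<partial>M) = 2 - 2 * affinity\<^sup>2"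
    using p_int q_int integrable_affinity p_total q_total by (simp add: affinity_def power2_eq_square)
  finally show ?thesis by (simp add: expand inner)
qed

end

section \<open>Fisher information bounds the difference of probabilities\<close>

text \<open>
  The right-hand side is half the Fisher information distance, written as an integral over the line.
  The bound comes from the Poincare inequality for \<open>g = \<psi> sqrt p\<close> with \<open>\<psi> = 1 / sqrt \<phi>\<close>.
\<close>

lemma Hellinger_le_Fisher:
  fixes p p' :: "real \<Rightarrow> real"
  assumes p': "has_Radon_Nikodym_derivative p p'" and p_cont: "continuous_on UNIV p"
    and pair: "density_pair lborel p std_normal_density"
  shows "ennreal (2 - 2 * density_pair.affinity lborel p std_normal_density)
    \<le> (\<integral>\<^sup>+r. ennreal (p r) * ennreal ((score p p' r + r)\<^sup>2) \<partial>lborel) / 2"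
proof -
  interpret density_pair lborel p std_normal_density by (rule pair)
  let ?\<phi> = std_normal_density
  define \<psi> where "\<psi> r = 1 / sqrt (?\<phi> r)" for r
  define \<psi>' where "\<psi>' r = r / 2 * \<psi> r" for r
  define w where "w r = \<psi> r * p' r / (2 * sqrt (p r)) + \<psi>' r * sqrt (p r)" for r
  define J where "J = (\<integral>\<^sup>+r. ennreal (p r) * ennreal ((score p p' r + r)\<^sup>2) \<partial>lborel)"
  have \<phi>_pos: "?\<phi> r > 0" for r by (simp add: normal_density_pos)
  have \<psi>_pos: "\<psi> r > 0" for r using \<phi>_pos[of r] by (simp add: \<psi>_def)
  have \<phi>_deriv: "(?\<phi> has_real_derivative - r * ?\<phi> r) (at r)" for r
    unfolding std_normal_density_def by (rule derivative_eq_intros refl | simp)+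
  have \<psi>_deriv: "(\<psi> has_real_derivative \<psi>' r) (at r)" for r
  proof -
    have "((\<lambda>r. sqrt (?\<phi> r)) has_real_derivative inverse (sqrt (?\<phi> r)) / 2 * (- r * ?\<phi> r)) (at r)"
      by (rule DERIV_chain2[OF DERIV_real_sqrt[OF \<phi>_pos] \<phi>_deriv])
    then have "(\<psi> has_real_derivative
        (0 * sqrt (?\<phi> r) - 1 * (inverse (sqrt (?\<phi> r)) / 2 * (- r * ?\<phi> r)))
          / (sqrt (?\<phi> r) * sqrt (?\<phi> r))) (at r)"
      unfolding \<psi>_def[abs_def] using \<phi>_pos[of r] by (intro DERIV_divide DERIV_const) auto
    also have "(0 * sqrt (?\<phi> r) - 1 * (inverse (sqrt (?\<phi> r)) / 2 * (- r * ?\<phi> r)))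
          / (sqrt (?\<phi> r) * sqrt (?\<phi> r)) = \<psi>' r"
      using \<phi>_pos[of r] by (simp add: \<psi>'_def \<psi>_def field_simps)
    finally show ?thesis .
  qed
  have \<psi>_cont: "continuous_on UNIV \<psi>"
    using \<psi>_deriv by (intro DERIV_continuous_on) (auto intro: has_field_derivative_at_within)
  have \<psi>'_cont: "continuous_on UNIV \<psi>'"
    unfolding \<psi>'_def by (intro continuous_intros \<psi>_cont) auto
  note [measurable] = RN_derivative_borel_measurable[OF p']
    borel_measurable_continuous_onI[OF p_cont] borel_measurable_continuous_onI[OF \<psi>_cont]
    borel_measurable_continuous_onI[OF \<psi>'_cont]
  have [measurable]: "w \<in> borel_measurable borel"
    unfolding w_def by measurable
  \<comment> \<open>Also at zeros of \<open>p\<close>: there \<open>w\<close> vanishes because \<open>sqrt 0 = 0\<close> and division by \<open>0\<close> gives \<open>0\<close>.\<close>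
  have w_energy: "(w r)\<^sup>2 * ?\<phi> r = p r * (score p p' r + r)\<^sup>2 / 4" for r
  proof (cases "p r = 0")
    case False
    then have "p r > 0" using p_nonneg[of r] by simp
    then obtain u where "u > 0" and u: "p r = u * u"
      by (metis real_sqrt_gt_zero real_sqrt_mult_self abs_of_pos)
    then have w_r: "w r = \<psi> r * (sqrt (p r) * (score p p' r + r) / 2)"
      by (simp add: w_def \<psi>'_def score_def u field_simps)
    have \<psi>_sq: "(\<psi> r)\<^sup>2 * ?\<phi> r = 1"
      using \<phi>_pos[of r] by (simp add: \<psi>_def power_divide)
    have "(w r)\<^sup>2 * ?\<phi> r = ((\<psi> r)\<^sup>2 * ?\<phi> r) * (sqrt (p r) * (score p p' r + r) / 2)\<^sup>2"
      unfolding w_r by (simp add: power_mult_distrib power_divide)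
    then have "(w r)\<^sup>2 * ?\<phi> r = (sqrt (p r) * (score p p' r + r) / 2)\<^sup>2"
      by (simp only: \<psi>_sq mult_1)
    then show ?thesis
      using \<open>p r > 0\<close> by (simp add: power_mult_distrib power_divide)
  qed (simp add: w_def)
  \<comment> \<open>The affinity lies between \<open>0\<close> and \<open>1\<close>, so it dominates its square.\<close>
  have "2 - 2 * affinity \<le> 2 - 2 * affinity\<^sup>2"
    using affinity_nonneg affinity_le_1 by (simp add: power2_eq_square mult_left_le)
  then have "ennreal (2 - 2 * affinity) \<le> ennreal (2 - 2 * affinity\<^sup>2)"
    by (rule ennreal_leI)
  also have "\<dots> = (\<integral>\<^sup>+a. \<integral>\<^sup>+b. ennreal ((\<psi> b * sqrt (p b) - \<psi> a * sqrt (p a))\<^sup>2 * ?\<phi> a * ?\<phi> b) \<partial>lborel \<partial>lborel)"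
    using two_point_integral_sqrt_ratio[OF \<phi>_pos] by (simp add: \<psi>_def)
  also have "\<dots> \<le> 2 * (\<integral>\<^sup>+r. ennreal ((w r)\<^sup>2) * ennreal (?\<phi> r) \<partial>lborel)"
    unfolding w_def
    using weighted_sqrt_increment_squared_le[OF p' p_cont p_nonneg \<psi>_deriv \<psi>'_cont \<psi>_pos]
    by (intro std_normal_two_point_Poincare) auto
  also have "(\<integral>\<^sup>+r. ennreal ((w r)\<^sup>2) * ennreal (?\<phi> r) \<partial>lborel)
      = (\<integral>\<^sup>+r. ennreal (1 / 4) * (ennreal (p r) * ennreal ((score p p' r + r)\<^sup>2)) \<partial>lborel)"
    using p_nonneg w_energy
    by (intro nn_integral_cong) (simp add: ennreal_mult[symmetric])
  also have "\<dots> = ennreal (1 / 4) * J"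
    unfolding J_def score_def by (intro nn_integral_cmult) measurable
  also have "2 * (ennreal (1 / 4) * J) = J / 2"
  proof -
    have half: "(2 :: ennreal) * ennreal (1 / 4) = ennreal (1 / 2)"
      using ennreal_mult[of 2 "1 / 4"] by simp
    have inv: "inverse (2 :: ennreal) = ennreal (1 / 2)"
      using inverse_ennreal[of 2] by (simp add: inverse_eq_divide)
    show ?thesis
      by (simp only: divide_ennreal_def mult.assoc[symmetric] half inv) (rule mult.commute)
  qed
  finally show ?thesis by (simp add: J_def)
qed

lemma ennreal_sqrt_mono_real:
  assumes "ennreal h \<le> a"
  shows "ennreal (sqrt h) \<le> ennreal_sqrt a"
proof (cases "a = \<infinity>")
  case False
  then obtain r where "a = ennreal r" "r \<ge> 0"
    by (cases a) auto
  with assms show ?thesis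
    by (simp add: ennreal_sqrt_def ennreal_le_iff ennreal_leI)
qed (simp add: ennreal_sqrt_def)

lemma prob_eq_set_integral_density:
  assumes "prob_space M" and D: "distributed M lborel F (\<lambda>y. ennreal (p y))"
    and p_nonneg: "\<And>y. 0 \<le> p y" and A: "A \<in> sets borel"
  shows "\<P>(\<omega> in M. F \<omega> \<in> A) = (LBINT y:A. p y)"
proof -
  interpret prob_space M by fact
  have [measurable]: "F \<in> borel_measurable M"
    using distributed_measurable[OF D] by simp
  have [measurable]: "p \<in> borel_measurable borel"
    using distributed_real_measurable[OF _ D] p_nonneg by simp
  have [measurable]: "A \<in> sets borel" by fact
  have "(LBINT y:A. p y) = (\<integral>y. p y * indicator A y \<partial>lborel)"
    by (simp add: set_lebesgue_integral_def mult.commute)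
  also have "\<dots> = (\<integral>\<omega>. indicator A (F \<omega>) \<partial>M)"
    using distributed_integral[OF D, of "indicator A"] p_nonneg by simp
  also have "\<dots> = (\<integral>\<omega>. indicator {\<omega> \<in> space M. F \<omega> \<in> A} \<omega> \<partial>M)"
    by (intro Bochner_Integration.integral_cong) (auto simp: indicator_def)
  also have "\<dots> = \<P>(\<omega> in M. F \<omega> \<in> A)"
    by simp
  finally show ?thesis by simp
qed

text \<open>
  The inequality for an arbitrary event \<open>A\<close>, with the probabilities of \<open>A\<close> itself under the roots.
\<close>

lemma event_difference_le_Fisher:
  fixes F :: "'a \<Rightarrow> real" and Z :: "'b \<Rightarrow> real"
  assumes M: "prob_space M" and N: "prob_space N"
    and p_nonneg: "\<And>y. 0 \<le> p y" and F: "distributed M lborel F (\<lambda>y. ennreal (p y))"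
    and p_cont: "continuous_on UNIV p" and p': "has_Radon_Nikodym_derivative p p'"
    and Z: "distributed N lborel Z (\<lambda>y. ennreal (std_normal_density y))"
    and A [measurable]: "A \<in> sets borel"
  shows "ennreal \<bar>\<P>(\<omega> in M. F \<omega> \<in> A) - \<P>(\<omega> in N. Z \<omega> \<in> A)\<bar>
    \<le> ennreal_sqrt (fisher_information_distance M F p p' / 2)
       * ennreal (sqrt \<P>(\<omega> in M. F \<omega> \<in> A) + sqrt \<P>(\<omega> in N. Z \<omega> \<in> A))"
proof -
  note probs = prob_eq_set_integral_density[OF M F p_nonneg] 
    prob_eq_set_integral_density[OF N Z normal_density_nonneg]
  note [measurable] = RN_derivative_borel_measurable[OF p'] borel_measurable_continuous_onI[OF p_cont]
  have total: "(\<integral>y. p y \<partial>lborel) = 1"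
    using probs(1)[of UNIV] prob_space.prob_space[OF M] by (simp add: set_lebesgue_integral_def)
  have "integrable lborel p"
    using total not_integrable_integral_eq by fastforce
  then have pair: "density_pair lborel p std_normal_density"
    using total p_nonneg integrable_normal_density[of 1 0] integral_normal_density[of 1 0]
    by unfold_locales auto
  interpret density_pair lborel p std_normal_density by (rule pair)
  have "fisher_information_distance M F p p'
      = (\<integral>\<^sup>+r. ennreal (p r) * ennreal ((score p p' r + r)\<^sup>2) \<partial>lborel)"
    unfolding fisher_information_distance_def score_def
    by (rule distributed_nn_integral[OF F, symmetric]) measurable
  then have "ennreal (2 - 2 * affinity) \<le> fisher_information_distance M F p p' / 2"
    using Hellinger_le_Fisher[OF p' p_cont pair] by simp
  then have sqrt_le: "ennreal (sqrt (2 - 2 * affinity)) \<le> ennreal_sqrt (fisher_information_distance M F p p' / 2)"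
    by (rule ennreal_sqrt_mono_real)
  let ?s = "sqrt \<P>(\<omega> in M. F \<omega> \<in> A) + sqrt \<P>(\<omega> in N. Z \<omega> \<in> A)"
  have "ennreal \<bar>\<P>(\<omega> in M. F \<omega> \<in> A) - \<P>(\<omega> in N. Z \<omega> \<in> A)\<bar> \<le> ennreal (sqrt (2 - 2 * affinity) * ?s)"
    using event_difference_le_Hellinger[of A] by (intro ennreal_leI) (simp add: probs)
  also have "\<dots> = ennreal (sqrt (2 - 2 * affinity)) * ennreal ?s"
    using affinity_le_1 by (intro ennreal_mult) auto
  also have "\<dots> \<le> ennreal_sqrt (fisher_information_distance M F p p' / 2) * ennreal ?s"
    by (intro mult_right_mono sqrt_le) simp
  finally show ?thesis .
qed

theorem theorem5p1:
  fixes M :: "'a measure" and N :: "'b measure"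
    and F :: "'a \<Rightarrow> real" and Z :: "'b \<Rightarrow> real"
    and p p' :: "real \<Rightarrow> real" and x :: real
  assumes "prob_space M" and "prob_space N"
    and "integrable M F" and "prob_space.expectation M F = 0"
    and "prob_space.variance M F = 1"
    and "\<And>y. 0 \<le> p y" and "distributed M lborel F (\<lambda>y. ennreal (p y))"
    and "locally_absolutely_continuous p"
    and "has_Radon_Nikodym_derivative p p'"
    and "distributed N lborel Z (\<lambda>y. ennreal (std_normal_density y))"
  shows "ennreal \<bar>\<P>(\<omega> in M. F \<omega> \<ge> x) - \<P>(\<omega> in N. Z \<omega> \<ge> x)\<bar>
    \<le> ennreal_sqrt (fisher_information_distance M F p p' / 2)
       * ennreal (sqrt \<P>(\<omega> in M. \<bar>F \<omega>\<bar> \<ge> \<bar>x\<bar>) + sqrt \<P>(\<omega> in N. \<bar>Z \<omega>\<bar> \<ge> \<bar>x\<bar>))"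
proof -
  interpret M: prob_space M by fact
  interpret N: prob_space N by fact
  have [measurable]: "F \<in> borel_measurable M" "Z \<in> borel_measurable N"
    using distributed_measurable[OF assms(7)] distributed_measurable[OF assms(10)] by auto
  define A where "A = (if 0 \<le> x then {x..} else {..<x})"
  have [measurable]: "A \<in> sets borel"
    by (simp add: A_def)
  have A_tail: "y \<in> A \<Longrightarrow> \<bar>y\<bar> \<ge> \<bar>x\<bar>" for y
    by (auto simp: A_def split: if_splits)
  have "\<bar>\<P>(\<omega> in M. F \<omega> \<ge> x) - \<P>(\<omega> in N. Z \<omega> \<ge> x)\<bar> = \<bar>\<P>(\<omega> in M. F \<omega> \<in> A) - \<P>(\<omega> in N. Z \<omega> \<in> A)\<bar>"
  proof (cases "0 \<le> x")
    case True
    then show ?thesis by (simp add: A_def)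
  next
    case False
    have "\<P>(\<omega> in M. F \<omega> < x) = 1 - \<P>(\<omega> in M. F \<omega> \<ge> x)"
      using M.prob_neg[of "\<lambda>\<omega>. F \<omega> \<ge> x"] by (simp add: not_le)
    moreover have "\<P>(\<omega> in N. Z \<omega> < x) = 1 - \<P>(\<omega> in N. Z \<omega> \<ge> x)"
      using N.prob_neg[of "\<lambda>\<omega>. Z \<omega> \<ge> x"] by (simp add: not_le)
    ultimately show ?thesis using False by (simp add: A_def)
  qed
  also have "ennreal \<dots> \<le> ennreal_sqrt (fisher_information_distance M F p p' / 2)
       * ennreal (sqrt \<P>(\<omega> in M. F \<omega> \<in> A) + sqrt \<P>(\<omega> in N. Z \<omega> \<in> A))"
    using assms by (intro event_difference_le_Fisher locally_absolutely_continuous_imp_continuous) auto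
  also have "\<dots> \<le> ennreal_sqrt (fisher_information_distance M F p p' / 2)
       * ennreal (sqrt \<P>(\<omega> in M. \<bar>F \<omega>\<bar> \<ge> \<bar>x\<bar>) + sqrt \<P>(\<omega> in N. \<bar>Z \<omega>\<bar> \<ge> \<bar>x\<bar>))"
    by (intro mult_left_mono ennreal_leI add_mono real_sqrt_le_mono M.finite_measure_mono N.finite_measure_mono)
       (auto intro: A_tail)
  finally show ?thesis .
qed

end
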